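(* Let $N\ge2$ and $d\ge1$ be integers. Let $f:\mathbb{Z}_N^d\to\mathbb{C}$ be supported in $E\subset\mathbb{Z}_N^d$ and let $S\subset\mathbb{Z}_N^d$ (the set of unobserved frequencies). Suppose that there exist $C>0$ and $\alpha\in[2,3]$ such that $$\Lambda(U)\le C|U|^{\alpha}\quad\text{for all } U\subset S.$$ For any $\beta>\alpha$, let $$\delta_\beta=\left(\frac{|E|\cdot|S|^{\beta-2}}{N^d}\right)^{\frac14}.$$ If $$\delta_\beta<\frac{1}{2\left(17+\frac{1}{1-2^{-(\beta-\alpha)}}\right)\cdot(2C)^{\frac14}}$$ and $g:\mathbb{Z}_N^d\to\mathbb{C}$ is a minimizer of $\|u\|_{L^2(\mathbb{Z}_N^d)}$ among all functions $u:\mathbb{Z}_N^d\to\mathbb{C}$ satisfying both $\widehat u(m)=\widehat f(m)$ for all $m\notin S$ and $|\mathrm{supp}(u)|=|E|$, then $f\equiv g$.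
   Context: $\mathbb{Z}_N=\mathbb{Z}/N\mathbb{Z}$, and $\chi(t)=e^{2\pi i t/N}$ for $t\in\mathbb{Z}_N$. The discrete Fourier transform of $f:\mathbb{Z}_N^d\to\mathbb{C}$ is $\widehat f(m)=N^{-d}\sum_{x\in\mathbb{Z}_N^d}\chi(-x\cdot m)f(x)$. "Supported in $E$" means $f(x)=0$ for $x\notin E$; $\mathrm{supp}(u)=\{x:u(x)\neq0\}$. For $A\subset\mathbb{Z}_N^d$, the additive energy is $\Lambda(A)=|\{(x_1,x_2,x_3,x_4)\in A^4: x_1+x_2=x_3+x_4\}|$. The norm is $\|u\|_{L^2(\mathbb{Z}_N^d)}=\left(\sum_{x\in\mathbb{Z}_N^d}|u(x)|^2\right)^{1/2}$. *)

theory Defs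
  imports "HOL-Analysis.Analysis" "Berlekamp_Zassenhaus.Finite_Field"
begin

text \<open>The ring of integers modulo \<open>N\<close> is \<open>'n mod_ring\<close> with \<open>N = CARD('n)\<close>; the class \<open>nontriv\<close>
  says exactly \<open>CARD('n) > 1\<close>.  The group of \<open>d\<close>-tuples is \<open>'n mod_ring ^ 'd\<close> with
  \<open>d = CARD('d)\<close>, which is at least 1 because types are nonempty.\<close>

text \<open>\<open>to_int_mod_ring\<close> picks the representative in \<open>{0..<N}\<close>; the value of the character does not
  depend on this choice.\<close>
definition additive_char :: "'n::nontriv mod_ring \<Rightarrow> complex" where
  "additive_char t =
     exp (2 * of_real pi * \<i> * of_int (to_int_mod_ring t) / of_nat CARD('n))"

definition dot_prod ::
  "'n::nontriv mod_ring ^ 'd::finite \<Rightarrow> 'n mod_ring ^ 'd \<Rightarrow> 'n mod_ring" where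
  "dot_prod x m = (\<Sum>i\<in>UNIV. x $ i * m $ i)"

definition dft ::
  "('n::nontriv mod_ring ^ 'd::finite \<Rightarrow> complex) \<Rightarrow> 'n mod_ring ^ 'd \<Rightarrow> complex" where
  "dft f m = (\<Sum>x\<in>UNIV. additive_char (- dot_prod x m) * f x) / of_nat (CARD('n) ^ CARD('d))"

definition supp :: "('a \<Rightarrow> complex) \<Rightarrow> 'a set" where
  "supp u = {x. u x \<noteq> 0}"

definition additive_energy :: "'a::ab_group_add set \<Rightarrow> nat" where
  "additive_energy A = card {(x1, x2, x3, x4).
     x1 \<in> A \<and> x2 \<in> A \<and> x3 \<in> A \<and> x4 \<in> A \<and> x1 + x2 = x3 + x4}"

text \<open>Counting measure, without the factor \<open>1 / N ^ d\<close>.\<close>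
definition L2_norm :: "('a::finite \<Rightarrow> complex) \<Rightarrow> real" where
  "L2_norm u = L2_set (\<lambda>x. cmod (u x)) UNIV"

end

theory Submission
  imports Defs
begin

text \<open>The difference \<open>h = f - g\<close> has at most \<open>2 |E|\<close> nonzero values and its transform \<open>a\<close> lives
  on \<open>S\<close>.  By Cauchy-Schwarz, \<open>\<parallel>h\<parallel>\<^sub>2\<^sup>4 \<le> 2 |E| \<parallel>h\<parallel>\<^sub>4\<^sup>4\<close>, while by Plancherel for \<open>h\<^sup>2\<close> the quantity
  \<open>\<parallel>h\<parallel>\<^sub>4\<^sup>4\<close> is \<open>N ^ d\<close> times a weighted additive energy, monotone in \<open>|a|\<close> and equal to
  \<open>N ^ d \<Lambda>(U)\<close> for an indicator.  Normalize \<open>\<parallel>a\<parallel>\<^sub>2 = 1\<close>.  The values \<open>|a| \<le> |S| powr (-1/2)\<close> are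
  dominated by one multiple of the indicator of \<open>S\<close>; the others are split into the dyadic levels
  \<open>2 ^ -(k+1) < |a| \<le> 2 ^ -k\<close> with \<open>4 ^ k < |S|\<close>, where the gap \<open>\<beta> - \<alpha>\<close> produces a factor
  \<open>2 powr (- k (\<beta> - \<alpha>) / 2)\<close>.  Cauchy-Schwarz over \<open>k\<close> (rather than bounding the levels one by one)
  gives an estimate for \<open>\<parallel>h\<parallel>\<^sub>4\<close> sharp enough that \<open>h \<noteq> 0\<close> would contradict the bound on \<open>\<delta>\<close>.\<close>

section \<open>Fourier inversion and Plancherel\<close>

lemma additive_char_add: "additive_char (s + t) = additive_char s * additive_char t"
  for s t :: "'n::nontriv mod_ring"
proof -
  define N where "N = int CARD('n)"
  define k where "k = to_int_mod_ring s + to_int_mod_ring t"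
  have N0: "of_nat CARD('n) = (of_int N :: complex)" "of_int N \<noteq> (0::complex)"
    by (simp_all add: N_def)
  have "complex_of_int k = of_int N * of_int (k div N) + of_int (k mod N)"
    by (metis mult_div_mod_eq of_int_add of_int_mult)
  \<comment> \<open>Reducing \<open>k\<close> modulo \<open>N\<close> changes the exponent by an
    integer multiple of 2 pi i, so the exponential does not see the choice of
    representative.\<close>
  hence "2 * of_real pi * \<i> * of_int (k mod N) / of_int N =
      2 * of_real pi * \<i> * of_int k / of_int N - (2 * of_int (k div N) * of_real pi) * \<i>"
    using N0(2) by (simp add: field_simps)
  hence "exp (2 * of_real pi * \<i> * of_int (k mod N) / of_int N) =
      exp (2 * of_real pi * \<i> * of_int k / of_int N)"
    using exp_integer_2pi[of "of_int (k div N)"] by (simp add: exp_diff)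
  moreover have "2 * of_real pi * \<i> * of_int k / (of_int N :: complex) =
      2 * of_real pi * \<i> * of_int (to_int_mod_ring s) / of_int N +
      2 * of_real pi * \<i> * of_int (to_int_mod_ring t) / of_int N"
    by (simp add: k_def field_simps add_divide_distrib)
  ultimately show ?thesis
    unfolding additive_char_def to_int_mod_ring_add N0(1)
    by (simp add: N_def[symmetric] k_def[symmetric] exp_add)
qed

lemma additive_char_0 [simp]: "additive_char 0 = 1"
  by (simp add: additive_char_def)

lemma norm_additive_char [simp]: "cmod (additive_char t) = 1"
proof -
  have "2 * of_real pi * \<i> * of_int (to_int_mod_ring t) / of_nat CARD('a) =
      \<i> * of_real (2 * pi * of_int (to_int_mod_ring t) / of_nat CARD('a))"
    by simp
  thus ?thesis unfolding additive_char_def by (simp only: norm_exp_i_times)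
qed

lemma cnj_additive_char: "cnj (additive_char t) = additive_char (- t)"
proof -
  have "additive_char t * cnj (additive_char t) = additive_char t * additive_char (- t)"
    using additive_char_add[of t "- t"] by (simp add: complex_norm_square[symmetric])
  moreover have "additive_char t \<noteq> 0"
    using norm_additive_char[of t] by (metis norm_zero zero_neq_one)
  ultimately show ?thesis by simp
qed

text \<open>The value 1 forces the representative to be a multiple of \<open>N\<close>, and the only
  multiple of \<open>N\<close> in {0..<N} is 0. Primality of \<open>N\<close> plays no part, so
  composite moduli are covered.\<close>

lemma additive_char_eq_1_iff: "additive_char t = 1 \<longleftrightarrow> t = 0"
  for t :: "'n::nontriv mod_ring"
proof
  assume "additive_char t = 1"
  then obtain n :: int where
    "2 * pi * of_int (to_int_mod_ring t) / real CARD('n) = of_int (2 * n) * pi"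
    unfolding additive_char_def exp_eq_1 by (auto simp: Im_divide_of_nat)
  hence "real_of_int (to_int_mod_ring t) = of_int (n * int CARD('n))"
    by (simp add: field_simps)
  hence n: "to_int_mod_ring t = n * int CARD('n)"
    by (simp only: of_int_eq_iff)
  have "to_int_mod_ring t \<in> {0..<int CARD('n)}"
    using range_to_int_mod_ring by blast
  hence "to_int_mod_ring t = to_int_mod_ring t mod int CARD('n)" by simp
  hence "to_int_mod_ring t = 0" using n by simp
  thus "t = 0" by simp
qed simp

lemma dot_prod_add_left: "dot_prod (x + y) m = dot_prod x m + dot_prod y m"
  and dot_prod_add_right: "dot_prod x (m + n) = dot_prod x m + dot_prod x n"
  and dot_prod_diff_right: "dot_prod x (m - n) = dot_prod x m - dot_prod x n"
  by (simp_all add: dot_prod_def algebra_simps sum.distrib sum_subtractf)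

lemma dot_prod_commute: "dot_prod x m = dot_prod m x"
  by (simp add: dot_prod_def mult.commute)

lemma dot_prod_axis: "dot_prod (axis i 1) m = m $ i"
proof -
  have "axis i 1 $ j * m $ j = (if j = i then m $ j else 0)" for j
    by (simp add: axis_def)
  thus ?thesis by (simp add: dot_prod_def)
qed

lemma additive_char_dot_prod_diff:
  "additive_char (dot_prod x (m - n)) = additive_char (dot_prod x m) * additive_char (- dot_prod x n)"
  using additive_char_add[of "dot_prod x m" "- dot_prod x n"] by (simp add: dot_prod_diff_right)

text \<open>Orthogonality of characters. If \<open>m $ i\<close> is nonzero, translating by the unit
  vector \<open>axis i 1\<close> multiplies the sum by \<open>additive_char (m $ i)\<close>, which
  is not 1, so the sum vanishes. Shifting by a unit vector avoids any trouble with zero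
  divisors.\<close>

lemma sum_additive_char_dot_prod:
  fixes m :: "'n::nontriv mod_ring ^ 'd::finite"
  shows "(\<Sum>x\<in>UNIV. additive_char (dot_prod x m)) = (if m = 0 then of_nat (CARD('n) ^ CARD('d)) else 0)"
proof (cases "m = 0")
  case True
  thus ?thesis by (simp add: dot_prod_def)
next
  case False
  then obtain i where i: "m $ i \<noteq> 0" by (auto simp: vec_eq_iff)
  let ?s = "\<Sum>x\<in>UNIV. additive_char (dot_prod x m)"
  have "?s = (\<Sum>x\<in>UNIV. additive_char (dot_prod (axis i 1 + x) m))"
    by (rule sum.reindex_bij_witness[of _ "\<lambda>x. axis i 1 + x" "\<lambda>x. x - axis i 1"]) auto
  also have "\<dots> = additive_char (m $ i) * ?s"
    by (simp add: dot_prod_add_left dot_prod_axis additive_char_add sum_distrib_left)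
  finally have "(1 - additive_char (m $ i)) * ?s = 0" by (simp add: algebra_simps)
  with i False show ?thesis by (simp add: additive_char_eq_1_iff)
qed

text \<open>Unnormalized, since \<open>dft\<close> already carries the factor 1/N^d. Pointwise
  products of inverse transforms then correspond to plain convolutions without a constant, and
  Plancherel has its factor N^d on the frequency side.\<close>

definition inverse_dft ::
  "('n::nontriv mod_ring ^ 'd::finite \<Rightarrow> complex) \<Rightarrow> 'n mod_ring ^ 'd \<Rightarrow> complex" where
  "inverse_dft a x = (\<Sum>m\<in>UNIV. a m * additive_char (dot_prod x m))"

lemma inverse_dft_dft: "inverse_dft (dft f) = f"
  for f :: "'n::nontriv mod_ring ^ 'd::finite \<Rightarrow> complex"
proof
  fix x
  define M :: complex where "M = of_nat (CARD('n) ^ CARD('d))"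
  have M: "M \<noteq> 0" by (simp add: M_def)
  have "inverse_dft (dft f) x =
      (\<Sum>m\<in>UNIV. \<Sum>y\<in>UNIV. f y / M * additive_char (dot_prod m (x - y)))"
    unfolding inverse_dft_def dft_def M_def[symmetric]
    by (simp add: sum_divide_distrib sum_distrib_right sum_distrib_left additive_char_dot_prod_diff
        dot_prod_commute[of x] dot_prod_commute[of _ "_ :: 'n mod_ring ^ 'd"] mult_ac)
  also have "\<dots> = (\<Sum>y\<in>UNIV. f y / M * (\<Sum>m\<in>UNIV. additive_char (dot_prod m (x - y))))"
    by (subst sum.swap) (simp add: sum_distrib_left)
  also have "\<dots> = (\<Sum>y\<in>UNIV. if y = x then f y else 0)"
    using M by (intro sum.cong refl) (auto simp: sum_additive_char_dot_prod M_def)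
  finally show "inverse_dft (dft f) x = f x" by simp
qed

lemma plancherel:
  fixes a :: "'n::nontriv mod_ring ^ 'd::finite \<Rightarrow> complex"
  shows "(\<Sum>x\<in>UNIV. (cmod (inverse_dft a x))\<^sup>2) = real (CARD('n) ^ CARD('d)) * (\<Sum>m\<in>UNIV. (cmod (a m))\<^sup>2)"
proof -
  define M :: complex where "M = of_nat (CARD('n) ^ CARD('d))"
  have "of_real (\<Sum>x\<in>UNIV. (cmod (inverse_dft a x))\<^sup>2) =
      (\<Sum>x\<in>UNIV. \<Sum>m\<in>UNIV. \<Sum>n\<in>UNIV. a m * cnj (a n) * additive_char (dot_prod x (m - n)))"
    unfolding of_real_sum complex_norm_square
    by (simp add: inverse_dft_def cnj_additive_char sum_product additive_char_dot_prod_diff mult_ac)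
  also have "\<dots> = (\<Sum>m\<in>UNIV. \<Sum>n\<in>UNIV. a m * cnj (a n) * (\<Sum>x\<in>UNIV. additive_char (dot_prod x (m - n))))"
    by (subst sum.swap, rule sum.cong[OF refl], subst sum.swap) (simp add: sum_distrib_left)
  also have "\<dots> = (\<Sum>m\<in>UNIV. \<Sum>n\<in>UNIV. if n = m then a m * cnj (a m) * M else 0)"
    by (intro sum.cong refl) (auto simp: sum_additive_char_dot_prod M_def)
  also have "\<dots> = of_real (real (CARD('n) ^ CARD('d)) * (\<Sum>m\<in>UNIV. (cmod (a m))\<^sup>2))"
    unfolding of_real_mult of_real_sum complex_norm_square by (simp add: M_def sum_distrib_left mult_ac)
  finally show ?thesis by (simp only: of_real_eq_iff)
qed

section \<open>The norm of the inverse transform in \<open>L\<^sup>4\<close> and additive energy\<close>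

definition convolution :: "('a::{finite,ab_group_add} \<Rightarrow> 'b::comm_semiring_0) \<Rightarrow> ('a \<Rightarrow> 'b) \<Rightarrow> 'a \<Rightarrow> 'b" where
  "convolution a b s = (\<Sum>t\<in>UNIV. a t * b (s - t))"

lemma inverse_dft_mult: "inverse_dft a x * inverse_dft b x = inverse_dft (convolution a b) x"
proof -
  have "inverse_dft a x * inverse_dft b x =
      (\<Sum>t\<in>UNIV. \<Sum>n\<in>UNIV. a t * b n * additive_char (dot_prod x (t + n)))"
    by (simp add: inverse_dft_def sum_product dot_prod_add_right additive_char_add mult_ac)
  also have "\<dots> = (\<Sum>t\<in>UNIV. \<Sum>s\<in>UNIV. a t * b (s - t) * additive_char (dot_prod x s))"
  proof (rule sum.cong[OF refl])
    fix t
    show "(\<Sum>n\<in>UNIV. a t * b n * additive_char (dot_prod x (t + n))) =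
        (\<Sum>s\<in>UNIV. a t * b (s - t) * additive_char (dot_prod x s))"
      by (rule sum.reindex_bij_witness[of _ "\<lambda>s. s - t" "\<lambda>n. t + n"]) auto
  qed
  also have "\<dots> = inverse_dft (convolution a b) x"
    by (subst sum.swap) (simp add: inverse_dft_def convolution_def sum_distrib_right)
  finally show ?thesis .
qed

text \<open>Encoded as the square root of the \<open>L2_set\<close> norm of |u|^2, so that the
  triangle and Cauchy-Schwarz inequalities for \<open>L2_set\<close> can be applied to it.\<close>

definition L4_norm :: "('a::finite \<Rightarrow> complex) \<Rightarrow> real" where
  "L4_norm u = sqrt (L2_set (\<lambda>x. (cmod (u x))\<^sup>2) UNIV)"

lemma L4_norm_nonneg [simp]: "L4_norm u \<ge> 0"
  by (simp add: L4_norm_def)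

lemma L4_norm_power2: "(L4_norm u)\<^sup>2 = L2_set (\<lambda>x. (cmod (u x))\<^sup>2) UNIV"
  by (simp add: L4_norm_def)

lemma L4_norm_power4: "L4_norm u ^ 4 = (\<Sum>x\<in>UNIV. cmod (u x) ^ 4)"
proof -
  have "L4_norm u ^ 4 = ((L4_norm u)\<^sup>2)\<^sup>2" by simp
  also have "\<dots> = (\<Sum>x\<in>UNIV. cmod (u x) ^ 4)"
    unfolding L4_norm_power2 L2_set_def by (simp add: sum_nonneg)
  finally show ?thesis .
qed

text \<open>Minkowski for exponent 4, reduced to exponent 2: bound |u + v|^2 by |u|^2 + 2|u||v| +
  |v|^2, apply the triangle inequality of \<open>L2_set\<close>, and estimate the mixed term by
  Cauchy-Schwarz for |u|^2 and |v|^2. The result is a perfect square.\<close>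

lemma L4_norm_triangle: "L4_norm (\<lambda>x. u x + v x) \<le> L4_norm u + L4_norm v"
proof -
  let ?U = "\<lambda>x. cmod (u x)" and ?V = "\<lambda>x. cmod (v x)"
  have "(\<Sum>x\<in>UNIV. (?U x * ?V x)\<^sup>2) \<le> (L4_norm u)\<^sup>2 * (L4_norm v)\<^sup>2"
    using L2_set_mult_ineq[of "\<lambda>x. (?U x)\<^sup>2" "\<lambda>x. (?V x)\<^sup>2" UNIV]
    by (simp add: L4_norm_power2 power_mult_distrib)
  hence uv: "L2_set (\<lambda>x. ?U x * ?V x) UNIV \<le> L4_norm u * L4_norm v"
    unfolding L2_set_def by (intro real_le_lsqrt) (auto simp: power_mult_distrib)
  have "(L4_norm (\<lambda>x. u x + v x))\<^sup>2 \<le> L2_set (\<lambda>x. ((?U x)\<^sup>2 + 2 * (?U x * ?V x)) + (?V x)\<^sup>2) UNIV"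
    unfolding L4_norm_power2
  proof (rule L2_set_mono)
    fix x
    have "(cmod (u x + v x))\<^sup>2 \<le> (?U x + ?V x)\<^sup>2"
      by (intro power_mono norm_triangle_ineq) auto
    thus "(cmod (u x + v x))\<^sup>2 \<le> (?U x)\<^sup>2 + 2 * (?U x * ?V x) + (?V x)\<^sup>2"
      by (simp add: power2_sum algebra_simps)
  qed simp
  also have "\<dots> \<le> L2_set (\<lambda>x. (?U x)\<^sup>2 + 2 * (?U x * ?V x)) UNIV + L2_set (\<lambda>x. (?V x)\<^sup>2) UNIV"
    by (rule L2_set_triangle_ineq)
  also have "\<dots> \<le> (L2_set (\<lambda>x. (?U x)\<^sup>2) UNIV + L2_set (\<lambda>x. 2 * (?U x * ?V x)) UNIV) + L2_set (\<lambda>x. (?V x)\<^sup>2) UNIV"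
    by (intro add_right_mono L2_set_triangle_ineq)
  also have "\<dots> = (L4_norm u)\<^sup>2 + 2 * L2_set (\<lambda>x. ?U x * ?V x) UNIV + (L4_norm v)\<^sup>2"
    by (simp only: L4_norm_power2 L2_set_right_distrib[symmetric])
  also have "\<dots> \<le> (L4_norm u + L4_norm v)\<^sup>2"
    using uv by (simp add: power2_sum algebra_simps)
  finally show ?thesis by (rule power2_le_imp_le) simp
qed

lemma L4_norm_0 [simp]: "L4_norm (\<lambda>x. 0) = 0"
  by (simp add: L4_norm_def L2_set_def)

lemma L4_norm_sum: "L4_norm (\<lambda>x. \<Sum>i\<in>I. u i x) \<le> (\<Sum>i\<in>I. L4_norm (u i))"
proof (induction I rule: infinite_finite_induct)
  case (insert i I)
  thus ?case using L4_norm_triangle[of "u i" "\<lambda>x. \<Sum>i\<in>I. u i x"] by simp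
qed simp_all

lemma L4_norm_mult: "L4_norm (\<lambda>x. c * u x) = cmod c * L4_norm u"
proof -
  have "L4_norm (\<lambda>x. c * u x) ^ 4 = (cmod c * L4_norm u) ^ 4"
    by (simp add: power_mult_distrib L4_norm_power4 norm_mult sum_distrib_left)
  thus ?thesis by (rule power_eq_imp_eq_base) auto
qed

lemma L4_norm_inverse_dft:
  fixes a :: "'n::nontriv mod_ring ^ 'd::finite \<Rightarrow> complex"
  shows "L4_norm (inverse_dft a) ^ 4 =
    real (CARD('n) ^ CARD('d)) * (\<Sum>s\<in>UNIV. (cmod (convolution a a s))\<^sup>2)"
proof -
  have "L4_norm (inverse_dft a) ^ 4 = (\<Sum>x\<in>UNIV. (cmod (inverse_dft a x * inverse_dft a x))\<^sup>2)"
    unfolding L4_norm_power4 by (simp add: norm_mult power4_eq_xxxx power2_eq_square mult_ac)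
  thus ?thesis by (simp only: inverse_dft_mult plancherel)
qed

text \<open>The fourth power is a sum of squared moduli of self-convolutions. The triangle
  inequality inside each convolution leaves an expression with nonnegative terms, monotone in the
  coefficients. This is what allows replacing \<open>a\<close> by a majorant.\<close>

lemma L4_norm_inverse_dft_mono:
  fixes a :: "'n::nontriv mod_ring ^ 'd::finite \<Rightarrow> complex"
  assumes "\<And>m. cmod (a m) \<le> b m"
  shows "L4_norm (inverse_dft a) \<le> L4_norm (inverse_dft (\<lambda>m. of_real (b m)))"
proof -
  let ?b = "\<lambda>m. complex_of_real (b m)"
  have b: "b m \<ge> 0" for m using assms[of m] norm_ge_zero order_trans by blast
  have "cmod (convolution a a s) \<le> cmod (convolution ?b ?b s)" for s
  proof -
    have "cmod (convolution a a s) \<le> (\<Sum>t\<in>UNIV. b t * b (s - t))"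
      unfolding convolution_def
      by (rule sum_norm_le) (simp add: norm_mult mult_mono assms b)
    also have "\<dots> = cmod (of_real (\<Sum>t\<in>UNIV. b t * b (s - t)))"
      by (subst norm_of_real) (simp add: sum_nonneg b)
    finally show ?thesis by (simp add: convolution_def)
  qed
  hence "L4_norm (inverse_dft a) ^ 4 \<le> L4_norm (inverse_dft ?b) ^ 4"
    unfolding L4_norm_inverse_dft by (intro mult_left_mono sum_mono power_mono) auto
  thus ?thesis by (simp add: power_mono_iff)
qed

text \<open>Once the common sum \<open>s\<close> is fixed, \<open>x1\<close> and \<open>x3\<close>
  can be chosen independently among the \<open>t\<close> in \<open>U\<close> with
  \<open>s - t\<close> in \<open>U\<close>, and they determine \<open>x2\<close> and
  \<open>x4\<close>.\<close>

lemma additive_energy_eq_sum: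
  "additive_energy U = (\<Sum>s\<in>UNIV. (card {t. t \<in> U \<and> s - t \<in> U})\<^sup>2)"
  for U :: "'a::{finite,ab_group_add} set"
proof -
  let ?R = "\<lambda>s. {t. t \<in> U \<and> s - t \<in> U}"
  have diff: "x3 + x4 - x1 = x2" if "x1 + x2 = x3 + x4" for x1 x2 x3 x4 :: 'a
    using that by (simp add: diff_eq_eq add.commute)
  have "bij_betw (\<lambda>(s, t, t'). (t, s - t, t', s - t')) (SIGMA s:UNIV. ?R s \<times> ?R s)
     {(x1, x2, x3, x4). x1 \<in> U \<and> x2 \<in> U \<and> x3 \<in> U \<and> x4 \<in> U \<and> x1 + x2 = x3 + x4}"
    by (rule bij_betw_byWitness[where f' = "\<lambda>(x1, x2, x3, x4). (x1 + x2, x1, x3)"])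
      (auto simp: diff)
  hence "additive_energy U = card (SIGMA s:UNIV. ?R s \<times> ?R s)"
    unfolding additive_energy_def by (simp add: bij_betw_same_card)
  thus ?thesis by (simp add: card_cartesian_product power2_eq_square)
qed

lemma L4_norm_inverse_dft_indicator:
  fixes U :: "('n::nontriv mod_ring ^ 'd::finite) set"
  shows "L4_norm (inverse_dft (\<lambda>m. of_bool (m \<in> U))) ^ 4 =
    real (CARD('n) ^ CARD('d)) * real (additive_energy U)"
proof -
  let ?u = "\<lambda>m. of_bool (m \<in> U) :: complex"
  have "convolution ?u ?u s = of_nat (card {t. t \<in> U \<and> s - t \<in> U})" for s
  proof -
    have "convolution ?u ?u s = (\<Sum>t\<in>UNIV. of_bool (t \<in> U \<and> s - t \<in> U))"
      unfolding convolution_def by (intro sum.cong refl) auto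
    thus ?thesis by (simp add: of_bool_def sum.If_cases)
  qed
  thus ?thesis by (simp add: L4_norm_inverse_dft additive_energy_eq_sum)
qed

section \<open>The restriction estimate\<close>

lemma powr_quarter_power4: "(x powr (1/4)) ^ 4 = x" if "x \<ge> 0" for x :: real
  using that powr_powr[of x "1/4" 4] by (simp add: powr_numeral)

lemma sum_geometric_le: "(\<Sum>k\<in>K. q ^ k) \<le> 1 / (1 - q)"
  if "finite K" "0 \<le> q" "q < 1" for q :: real
  using sum_le_suminf[of "\<lambda>k. q ^ k" K] that by (simp add: suminf_geometric summable_geometric)

lemma dyadic_interval:
  fixes a :: real
  assumes "0 < a" "a \<le> 1"
  obtains k where "(1/2) ^ Suc k < a" "a \<le> (1/2) ^ k"
proof -
  obtain n where "(1/2) ^ n < a" using real_arch_pow_inv[of a "1/2"] assms by auto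
  moreover have "\<not> (1/2) ^ 0 < a" using assms by simp
  \<comment> \<open>The inequality (1/2)^j < a fails at j = 0 and holds at j = n, so it switches
    from false to true between two consecutive exponents. The closed upper end makes a = 1 fall into
    level 0.\<close>
  ultimately have "\<exists>k<n. \<not> (1/2) ^ k < a \<and> (1/2) ^ Suc k < a"
    by (induction n) (auto simp: less_Suc_eq)
  thus ?thesis using that by fastforce
qed

lemma L4_norm_inverse_dft_indicator_le:
  fixes U :: "('n::nontriv mod_ring ^ 'd::finite) set"
  assumes "real (additive_energy U) \<le> C * real (card U) powr \<alpha>" "C > 0"
  shows "L4_norm (inverse_dft (\<lambda>m. of_bool (m \<in> U))) \<le>
    (real (CARD('n) ^ CARD('d)) * C) powr (1/4) * real (card U) powr (\<alpha> / 4)"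
proof -
  let ?M = "real (CARD('n) ^ CARD('d))"
  have "(real (card U) powr (\<alpha> / 4)) ^ 4 = real (card U) powr \<alpha>"
    using powr_powr[of "real (card U)" "\<alpha>/4" 4] by (simp add: powr_numeral)
  hence "((?M * C) powr (1/4) * real (card U) powr (\<alpha> / 4)) ^ 4 = ?M * (C * real (card U) powr \<alpha>)"
    using assms(2) by (simp add: power_mult_distrib powr_quarter_power4)
  hence "L4_norm (inverse_dft (\<lambda>m. of_bool (m \<in> U))) ^ 4 \<le>
      ((?M * C) powr (1/4) * real (card U) powr (\<alpha> / 4)) ^ 4"
    unfolding L4_norm_inverse_dft_indicator using assms(1) by (simp add: mult_left_mono)
  thus ?thesis by (simp add: power_mono_iff)
qed

text \<open>Here \<open>n\<close> stands for the size of a level and \<open>T\<close> for that of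
  \<open>S\<close>. The factor \<open>sqrt n\<close> is split off for a later Cauchy-Schwarz. The
  rest is at most T^((\<alpha>-2)/4) = T^((\<beta>-2)/4) T^(-(\<beta>-\<alpha>)/4), and T \<ge> 4^k
  turns the last factor into geometric decay in \<open>k\<close>.\<close>

lemma powr_dyadic_level_le:
  fixes n T \<alpha> \<beta> :: real
  assumes "0 \<le> n" "n \<le> T" "4 ^ k \<le> T" "2 \<le> \<alpha>" "\<alpha> < \<beta>"
  shows "n powr (\<alpha> / 4) \<le> sqrt n * (T powr ((\<beta> - 2) / 4) * (2 powr (- (\<beta> - \<alpha>) / 2)) ^ k)"
proof -
  have "(4::real) ^ k = 2 powr (2 * real k)"
    by (simp add: powr_powr[symmetric] powr_realpow[symmetric])
  hence "(4 ^ k) powr ((\<beta> - \<alpha>) / 4) = (2::real) powr ((\<beta> - \<alpha>) / 2 * real k)"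
    by (simp add: powr_powr) (simp add: field_simps)
  moreover have "(4 ^ k) powr ((\<beta> - \<alpha>) / 4) \<le> T powr ((\<beta> - \<alpha>) / 4)"
    using assms by (intro powr_mono2) auto
  ultimately have "1 \<le> T powr ((\<beta> - \<alpha>) / 4) * 2 powr (- ((\<beta> - \<alpha>) / 2 * real k))"
    by (simp add: powr_minus field_simps)
  also have "2 powr (- ((\<beta> - \<alpha>) / 2 * real k)) = (2 powr (- (\<beta> - \<alpha>) / 2)) ^ k"
  proof -
    have "- ((\<beta> - \<alpha>) / 2 * real k) = - (\<beta> - \<alpha>) / 2 * real k" by (simp add: field_simps)
    thus ?thesis by (simp only: powr_powr[symmetric]) (simp add: powr_realpow)
  qed
  finally have 1: "1 \<le> T powr ((\<beta> - \<alpha>) / 4) * (2 powr (- (\<beta> - \<alpha>) / 2)) ^ k" .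
  have "n powr ((\<alpha> - 2) / 4) \<le> T powr ((\<alpha> - 2) / 4)"
    using assms by (intro powr_mono2) auto
  also have "\<dots> \<le> T powr ((\<alpha> - 2) / 4) * (T powr ((\<beta> - \<alpha>) / 4) * (2 powr (- (\<beta> - \<alpha>) / 2)) ^ k)"
    using mult_left_mono[OF 1, of "T powr ((\<alpha> - 2) / 4)"] by simp
  also have "\<dots> = T powr ((\<beta> - 2) / 4) * (2 powr (- (\<beta> - \<alpha>) / 2)) ^ k"
    by (simp add: mult.assoc[symmetric] powr_add[symmetric] field_simps)
  finally have "sqrt n * n powr ((\<alpha> - 2) / 4) \<le>
      sqrt n * (T powr ((\<beta> - 2) / 4) * (2 powr (- (\<beta> - \<alpha>) / 2)) ^ k)"
    using assms(1) by (intro mult_left_mono) auto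
  moreover have "n powr (\<alpha> / 4) = sqrt n * n powr ((\<alpha> - 2) / 4)"
    using powr_add[of n "1/2" "(\<alpha> - 2) / 4"] assms(1) by (simp add: powr_half_sqrt field_simps)
  ultimately show ?thesis by simp
qed

text \<open>In the final factor, 1 comes from the multiple of the indicator of \<open>S\<close> that
  covers the small values, and the other summand from all dyadic levels together.\<close>

lemma L4_norm_inverse_dft_le_normalized:
  fixes a :: "'n::nontriv mod_ring ^ 'd::finite \<Rightarrow> real"
  assumes energy: "\<And>U. U \<subseteq> S \<Longrightarrow> real (additive_energy U) \<le> C * real (card U) powr \<alpha>"
    and "C > 0" "2 \<le> \<alpha>" "\<alpha> < \<beta>"
    and a_nonneg: "\<And>m. a m \<ge> 0" and a_supp: "\<And>m. m \<notin> S \<Longrightarrow> a m = 0"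
    and a_norm: "(\<Sum>m\<in>UNIV. (a m)\<^sup>2) = 1"
  shows "L4_norm (inverse_dft (\<lambda>m. of_real (a m))) \<le>
    (real (CARD('n) ^ CARD('d)) * C) powr (1/4) * real (card S) powr ((\<beta> - 2) / 4) *
      (1 + 2 / (1 - 2 powr (- (\<beta> - \<alpha>))))"
proof -
  define T where "T = real (card S)"
  define Q where "Q = (real (CARD('n) ^ CARD('d)) * C) powr (1/4)"
  \<comment> \<open>The exponent is halved because Cauchy-Schwarz over \<open>k\<close> squares the
    ratio; the geometric series with ratio \<open>y^2\<close> is bounded by
    \<open>X\<close>.\<close>
  define y :: real where "y = 2 powr (- (\<beta> - \<alpha>) / 2)"
  define X where "X = 1 / (1 - 2 powr (- (\<beta> - \<alpha>)))"
  define R where "R = T powr ((\<beta> - 2) / 4)"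
  define A where "A k = {m \<in> S. (1/2) ^ Suc k < a m \<and> a m \<le> (1/2) ^ k}" for k
  \<comment> \<open>The condition 4^k < T says (1/2)^k > 1/sqrt T: only these levels can contain
    values above the threshold 1/sqrt T.\<close>
  define K where "K = {k. (4::real) ^ k < T}"
  define F where "F U = inverse_dft (\<lambda>m. of_bool (m \<in> U))" for U :: "('n mod_ring ^ 'd) set"
  \<comment> \<open>The majorant of \<open>a\<close>: each level is weighted by its upper end, and
    values up to 1/sqrt T are absorbed by the indicator of \<open>S\<close>.\<close>
  define b where "b m = 1 / sqrt T * of_bool (m \<in> S) + (\<Sum>k\<in>K. (1/2) ^ k * of_bool (m \<in> A k))" for m
  have "S \<noteq> {}" using a_supp a_norm by (auto simp: fun_eq_iff)
  hence T1: "T \<ge> 1"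
    unfolding T_def using card_gt_0_iff[of S] by simp
  have y2: "y\<^sup>2 = 2 powr (- (\<beta> - \<alpha>))"
    unfolding y_def power2_eq_square powr_add[symmetric] by (simp only: field_sum_of_halves)
  have y_lt: "0 \<le> y\<^sup>2" "y\<^sup>2 < 1"
    using \<open>\<alpha> < \<beta>\<close> by (simp, unfold y2, simp add: powr_less_one)
  have X1: "X \<ge> 1" using y_lt unfolding X_def y2[symmetric] by (simp add: field_simps)
  have finK: "finite K"
  proof (rule finite_subset)
    show "K \<subseteq> {..card S}"
    proof
      fix k assume "k \<in> K"
      hence "4 ^ k < card S" unfolding K_def T_def
        by (metis (mono_tags) mem_Collect_eq of_nat_less_iff of_nat_numeral of_nat_power)
      moreover have "k < 4 ^ k" by (rule less_exp[THEN less_le_trans]) (simp add: power_mono)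
      ultimately show "k \<in> {..card S}" by simp
    qed
  qed simp
  have F_le: "L4_norm (F U) \<le> Q * real (card U) powr (\<alpha> / 4)" if "U \<subseteq> S" for U
    unfolding F_def Q_def by (intro L4_norm_inverse_dft_indicator_le energy that \<open>C > 0\<close>)
  have a_le: "a m \<le> b m" for m
  proof (cases "m \<in> S")
    case False
    thus ?thesis by (simp add: a_supp b_def sum_nonneg)
  next
    case mS: True
    show ?thesis
    proof (cases "a m \<le> 1 / sqrt T")
      case True
      have "0 \<le> (\<Sum>k\<in>K. (1/2) ^ k * of_bool (m \<in> A k) :: real)" by (simp add: sum_nonneg)
      thus ?thesis using True mS by (simp add: b_def)
    next
      case False
      hence gt: "1 / sqrt T < a m" by simp
      have "(a m)\<^sup>2 \<le> 1" unfolding a_norm[symmetric] by (rule member_le_sum) auto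
      hence "a m \<le> 1" using a_nonneg by (simp add: power2_le_iff_abs_le abs_square_le_1)
      moreover have "0 < a m" using gt T1 by (smt (verit) divide_nonneg_nonneg real_sqrt_ge_zero)
      ultimately obtain k where k: "(1/2) ^ Suc k < a m" "a m \<le> (1/2) ^ k"
        using dyadic_interval by blast
      hence mA: "m \<in> A k" using mS by (simp add: A_def)
      have "1 / sqrt T < (1/2) ^ k" using gt k by linarith
      hence "(1 / sqrt T)\<^sup>2 < ((1/2) ^ k)\<^sup>2" using T1 by (intro power_strict_mono) auto
      hence "1 / T < (1/4) ^ k"
        using T1 by (simp add: power_divide power_mult[symmetric] mult.commute[of k] power_mult)
      hence "k \<in> K" using T1 by (simp add: K_def field_simps power_divide)
      hence "(1/2) ^ k * of_bool (m \<in> A k) \<le> (\<Sum>k\<in>K. (1/2) ^ k * of_bool (m \<in> A k) :: real)"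
        by (intro member_le_sum finK) auto
      hence "a m \<le> (\<Sum>k\<in>K. (1/2) ^ k * of_bool (m \<in> A k))" using k mA by simp
      moreover have "0 \<le> 1 / sqrt T" using T1 by simp
      ultimately show ?thesis using mS unfolding b_def by (simp only: of_bool_eq mult_1_right)
    qed
  qed
  have "L4_norm (inverse_dft (\<lambda>m. of_real (a m))) \<le> L4_norm (inverse_dft (\<lambda>m. of_real (b m)))"
    by (rule L4_norm_inverse_dft_mono) (simp add: a_le a_nonneg)
  also have "inverse_dft (\<lambda>m. of_real (b m)) =
      (\<lambda>x. of_real (1 / sqrt T) * F S x + (\<Sum>k\<in>K. of_real ((1/2) ^ k) * F (A k) x))"
  proof
    fix x :: "'n mod_ring ^ 'd"
    let ?e = "\<lambda>m. additive_char (dot_prod x m)"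
    have of_bool: "complex_of_real (of_bool p) = of_bool p" for p by (cases p) simp_all
    have "inverse_dft (\<lambda>m. of_real (b m)) x =
        (\<Sum>m\<in>UNIV. of_real (1 / sqrt T) * (of_bool (m \<in> S) * ?e m) +
          (\<Sum>k\<in>K. of_real ((1/2) ^ k) * (of_bool (m \<in> A k) * ?e m)))"
      unfolding inverse_dft_def b_def
      by (intro sum.cong refl) (simp add: distrib_right sum_distrib_right mult.assoc of_bool)
    also have "\<dots> = of_real (1 / sqrt T) * F S x + (\<Sum>k\<in>K. of_real ((1/2) ^ k) * F (A k) x)"
      unfolding F_def inverse_dft_def sum_distrib_left sum.distrib
      by (subst (2) sum.swap) simp
    finally show "inverse_dft (\<lambda>m. of_real (b m)) x = \<dots>" .
  qed
  also have "L4_norm \<dots> \<le> L4_norm (\<lambda>x. of_real (1 / sqrt T) * F S x) +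
      (\<Sum>k\<in>K. L4_norm (\<lambda>x. of_real ((1/2) ^ k) * F (A k) x))"
    by (rule order_trans[OF L4_norm_triangle add_left_mono[OF L4_norm_sum]])
  also have "\<dots> = 1 / sqrt T * L4_norm (F S) + (\<Sum>k\<in>K. (1/2) ^ k * L4_norm (F (A k)))"
    using T1 unfolding L4_norm_mult by (simp add: norm_power norm_divide)
  also have "1 / sqrt T * L4_norm (F S) \<le> Q * R"
  \<comment> \<open>The weight 1/sqrt T cancels T^(1/2) out of T^(\<alpha>/4); since T \<ge> 1, the
    remaining exponent (\<alpha>-2)/4 may be raised to (\<beta>-2)/4.\<close>
  proof -
    have "1 / sqrt T * L4_norm (F S) \<le> 1 / sqrt T * (Q * T powr (\<alpha> / 4))"
      using F_le[of S] T1 by (intro mult_left_mono) (auto simp: T_def)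
    also have "\<dots> = Q * T powr ((\<alpha> - 2) / 4)"
    proof -
      have "T powr (\<alpha> / 4) = T powr (1/2) * T powr ((\<alpha> - 2) / 4)"
        unfolding powr_add[symmetric] by (simp add: field_simps)
      thus ?thesis using T1 by (simp add: powr_half_sqrt)
    qed
    also have "\<dots> \<le> Q * R"
      unfolding R_def Q_def using T1 \<open>\<alpha> < \<beta>\<close> by (intro mult_left_mono powr_mono) auto
    finally show ?thesis .
  qed
  also have "(\<Sum>k\<in>K. (1/2) ^ k * L4_norm (F (A k))) \<le> Q * R * (2 * X)"
  proof -
    let ?c = "\<lambda>k. real (card (A k))"
    have "(\<Sum>k\<in>K. (1/2) ^ k * L4_norm (F (A k))) \<le>
        (\<Sum>k\<in>K. (1/2) ^ k * (Q * (sqrt (?c k) * (R * y ^ k))))"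
    proof (intro sum_mono mult_left_mono)
      fix k assume "k \<in> K"
      have "L4_norm (F (A k)) \<le> Q * ?c k powr (\<alpha> / 4)"
        by (rule F_le) (auto simp: A_def)
      also have "\<dots> \<le> Q * (sqrt (?c k) * (R * y ^ k))"
        unfolding R_def y_def
      proof (intro mult_left_mono powr_dyadic_level_le)
        show "?c k \<le> T" unfolding T_def A_def by (intro of_nat_mono card_mono) auto
      qed (use \<open>k \<in> K\<close> assms in \<open>auto simp: K_def Q_def\<close>)
      finally show "L4_norm (F (A k)) \<le> Q * (sqrt (?c k) * (R * y ^ k))" .
    qed simp
    also have "\<dots> = Q * R * (\<Sum>k\<in>K. ((1/2) ^ k * sqrt (?c k)) * y ^ k)"
      by (simp add: sum_distrib_left mult_ac)
    also have "(\<Sum>k\<in>K. ((1/2) ^ k * sqrt (?c k)) * y ^ k) \<le> 2 * X"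
    proof -
      \<comment> \<open>The first Cauchy-Schwarz factor is the sum of 4^(-k) |A k|. On
        \<open>A k\<close> the value of \<open>a\<close> exceeds half of (1/2)^k, and the levels are
        disjoint, so this is at most four times the squared norm of \<open>a\<close>, which is
        1.\<close>
      have "(\<Sum>k\<in>K. ((1/2) ^ k * sqrt (?c k))\<^sup>2) = (\<Sum>k\<in>K. \<Sum>m\<in>A k. ((1/2) ^ k)\<^sup>2)"
        by (simp add: power_mult_distrib mult_ac)
      also have "\<dots> \<le> (\<Sum>k\<in>K. \<Sum>m\<in>A k. 4 * (a m)\<^sup>2)"
      proof (intro sum_mono)
        fix k m assume "m \<in> A k"
        hence "(1/2) ^ k \<le> 2 * a m" by (simp add: A_def)
        hence "((1/2) ^ k)\<^sup>2 \<le> (2 * a m)\<^sup>2" by (intro power_mono) auto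
        thus "((1/2) ^ k)\<^sup>2 \<le> 4 * (a m)\<^sup>2" by (simp add: power_mult_distrib)
      qed
      also have "\<dots> = (\<Sum>m\<in>(\<Union>k\<in>K. A k). 4 * (a m)\<^sup>2)"
      proof (rule sum.UNION_disjoint[symmetric, OF finK])
        have "A i \<inter> A j = {}" if "i < j" for i j
        proof -
          have "(1/2::real) ^ j \<le> (1/2) ^ Suc i" using that by (intro power_decreasing) auto
          thus ?thesis unfolding A_def by force
        qed
        thus "\<forall>i\<in>K. \<forall>j\<in>K. i \<noteq> j \<longrightarrow> A i \<inter> A j = {}"
          by (metis Int_commute linorder_neqE_nat)
      qed simp
      also have "\<dots> \<le> (\<Sum>m\<in>UNIV. 4 * (a m)\<^sup>2)" by (rule sum_mono2) auto
      also have "\<dots> = 4" by (simp add: sum_distrib_left[symmetric] a_norm)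
      finally have 1: "(\<Sum>k\<in>K. ((1/2) ^ k * sqrt (?c k))\<^sup>2) \<le> 4" .
      have "(\<Sum>k\<in>K. (y ^ k)\<^sup>2) = (\<Sum>k\<in>K. (y\<^sup>2) ^ k)"
        by (simp add: power_mult[symmetric] mult.commute)
      also have "\<dots> \<le> X" using sum_geometric_le[OF finK y_lt] by (simp add: X_def y2)
      finally have 2: "(\<Sum>k\<in>K. (y ^ k)\<^sup>2) \<le> X" .
      have "(\<Sum>k\<in>K. ((1/2) ^ k * sqrt (?c k)) * y ^ k)\<^sup>2 \<le>
          (\<Sum>k\<in>K. ((1/2) ^ k * sqrt (?c k))\<^sup>2) * (\<Sum>k\<in>K. (y ^ k)\<^sup>2)"
        by (rule Cauchy_Schwarz_ineq_sum)
      also have "\<dots> \<le> 4 * X"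
        by (rule mult_mono[OF 1 2]) (simp_all add: sum_nonneg)
      \<comment> \<open>Cauchy-Schwarz gives 2 sqrt X; as X \<ge> 1, this is relaxed to 2 X.\<close>
      also have "\<dots> \<le> (2 * X)\<^sup>2" using X1 by (simp add: power2_eq_square)
      finally show ?thesis by (rule power2_le_imp_le) (use X1 in simp)
    qed
    finally show ?thesis by (simp add: mult_left_mono Q_def R_def)
  qed
  finally show ?thesis by (simp add: Q_def R_def X_def T_def algebra_simps)
qed

text \<open>Both sides are homogeneous in \<open>a\<close>, and passing to moduli does not decrease
  the left side, so the normalized estimate applies to |a| divided by its norm. Only
  \<open>a = 0\<close> has to be treated apart.\<close>

lemma L4_norm_inverse_dft_le_L2_norm:
  fixes a :: "'n::nontriv mod_ring ^ 'd::finite \<Rightarrow> complex"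
  assumes energy: "\<And>U. U \<subseteq> S \<Longrightarrow> real (additive_energy U) \<le> C * real (card U) powr \<alpha>"
    and "C > 0" "2 \<le> \<alpha>" "\<alpha> < \<beta>"
    and a_supp: "\<And>m. m \<notin> S \<Longrightarrow> a m = 0"
  shows "L4_norm (inverse_dft a) \<le>
    (real (CARD('n) ^ CARD('d)) * C) powr (1/4) * real (card S) powr ((\<beta> - 2) / 4) *
      (1 + 2 / (1 - 2 powr (- (\<beta> - \<alpha>)))) * L2_norm a"
    (is "_ \<le> ?B * _")
proof (cases "L2_norm a = 0")
  case True
  hence "a = (\<lambda>m. 0)" by (simp add: L2_norm_def L2_set_eq_0_iff fun_eq_iff)
  hence "inverse_dft a = (\<lambda>x. 0)" by (simp add: inverse_dft_def fun_eq_iff)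
  thus ?thesis using True by simp
next
  case False
  define c where "c = L2_norm a"
  have c: "c > 0" using False by (simp add: c_def L2_norm_def order_less_le)
  have c2: "(\<Sum>m\<in>UNIV. (cmod (a m))\<^sup>2) = c\<^sup>2"
    by (simp add: c_def L2_norm_def L2_set_def sum_nonneg)
  have "L4_norm (inverse_dft a) \<le> L4_norm (inverse_dft (\<lambda>m. of_real (cmod (a m))))"
    by (rule L4_norm_inverse_dft_mono) simp
  also have "inverse_dft (\<lambda>m. of_real (cmod (a m))) =
      (\<lambda>x. of_real c * inverse_dft (\<lambda>m. of_real (cmod (a m) / c)) x)"
    using c by (simp add: inverse_dft_def sum_distrib_left fun_eq_iff)
  also have "L4_norm \<dots> = c * L4_norm (inverse_dft (\<lambda>m. of_real (cmod (a m) / c)))"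
    using c by (simp add: L4_norm_mult)
  also have "\<dots> \<le> c * ?B"
  proof (intro mult_left_mono L4_norm_inverse_dft_le_normalized energy)
    show "(\<Sum>m\<in>UNIV. (cmod (a m) / c)\<^sup>2) = 1"
      using c by (simp add: power_divide sum_divide_distrib[symmetric] c2)
  qed (use assms c in auto)
  finally show ?thesis by (simp add: c_def mult_ac)
qed

section \<open>Uniqueness\<close>

text \<open>Cauchy-Schwarz of |u|^2 against the constant 1 on the support; a small support forces
  the L^4 norm to be large relative to the L^2 norm.\<close>

lemma L2_norm_power4_le: "L2_norm u ^ 4 \<le> real (card (supp u)) * L4_norm u ^ 4"
proof -
  have "L2_norm u ^ 4 = ((L2_norm u)\<^sup>2)\<^sup>2" by simp
  also have "(L2_norm u)\<^sup>2 = (\<Sum>x\<in>UNIV. (cmod (u x))\<^sup>2)"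
    by (simp add: L2_norm_def L2_set_def sum_nonneg)
  also have "\<dots> = (\<Sum>x\<in>supp u. 1 * (cmod (u x))\<^sup>2)"
    by (simp, rule sum.mono_neutral_right) (auto simp: supp_def)
  also have "\<dots>\<^sup>2 \<le> (\<Sum>x\<in>supp u. 1\<^sup>2) * (\<Sum>x\<in>supp u. ((cmod (u x))\<^sup>2)\<^sup>2)"
    by (rule Cauchy_Schwarz_ineq_sum)
  also have "\<dots> \<le> real (card (supp u)) * L4_norm u ^ 4"
    unfolding L4_norm_power4 by (simp, intro mult_left_mono sum_mono2) auto
  finally show ?thesis .
qed

text \<open>A nonzero function cannot have both small support and spectrum in a set of low additive
  energy: small support bounds the L^4 norm from below, the restriction estimate for
  \<open>dft h\<close> bounds it from above, and Plancherel compares the two L^2 norms.\<close>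

lemma energy_uncertainty_principle:
  fixes h :: "'n::nontriv mod_ring ^ 'd::finite \<Rightarrow> complex"
  assumes energy: "\<And>U. U \<subseteq> S \<Longrightarrow> real (additive_energy U) \<le> C * real (card U) powr \<alpha>"
    and "C > 0" "2 \<le> \<alpha>" "\<alpha> < \<beta>"
    and supp: "\<And>m. m \<notin> S \<Longrightarrow> dft h m = 0" and "h \<noteq> (\<lambda>x. 0)"
  shows "1 \<le> real (card (supp h)) * real (card S) powr (\<beta> - 2) / real (CARD('n) ^ CARD('d)) * C *
    (1 + 2 / (1 - 2 powr (- (\<beta> - \<alpha>)))) ^ 4"
proof -
  define M where "M = real (CARD('n) ^ CARD('d))"
  define c where "c = L2_norm (dft h)"
  define Y where "Y = 1 + 2 / (1 - 2 powr (- (\<beta> - \<alpha>)))"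
  define P where "P = real (card S) powr (\<beta> - 2)"
  have M: "M > 0" by (simp add: M_def)
  have "dft h \<noteq> (\<lambda>m. 0)"
  proof
    assume "dft h = (\<lambda>m. 0)"
    hence "inverse_dft (dft h) = (\<lambda>x. 0)" by (simp add: inverse_dft_def fun_eq_iff)
    thus False using \<open>h \<noteq> (\<lambda>x. 0)\<close> by (simp add: inverse_dft_dft)
  qed
  hence c: "c > 0" by (auto simp: c_def L2_norm_def order_less_le L2_set_eq_0_iff fun_eq_iff)
  have "(L2_norm h)\<^sup>2 = M * c\<^sup>2"
    using plancherel[of "dft h"] unfolding inverse_dft_dft
    by (simp add: L2_norm_def L2_set_def sum_nonneg M_def c_def)
  hence "L2_norm h ^ 4 = M\<^sup>2 * c ^ 4"
    using power_mult[of "L2_norm h" 2 2] by (simp add: power_mult_distrib)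
  moreover have "L4_norm h ^ 4 \<le> M * C * P * Y ^ 4 * c ^ 4"
  proof -
    have "L4_norm h \<le> (M * C) powr (1/4) * real (card S) powr ((\<beta> - 2) / 4) * Y * c"
      unfolding M_def c_def Y_def using L4_norm_inverse_dft_le_L2_norm[of S C \<alpha> \<beta> "dft h", unfolded inverse_dft_dft] assms
      by blast
    hence "L4_norm h ^ 4 \<le> ((M * C) powr (1/4) * real (card S) powr ((\<beta> - 2) / 4) * Y * c) ^ 4"
      by (intro power_mono) auto
    moreover have "(real (card S) powr ((\<beta> - 2) / 4)) ^ 4 = P"
      using powr_quarter_power4[of P] powr_powr[of "real (card S)" "\<beta> - 2" "1/4"]
      by (simp add: P_def)
    ultimately show ?thesis
      using M \<open>C > 0\<close> by (simp add: power_mult_distrib powr_quarter_power4)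
  qed
  \<comment> \<open>Plancherel contributes M^2 on the left and the restriction estimate only
    \<open>M\<close> on the right; cancelling M c^4 leaves the single factor N^d of the
    claim.\<close>
  ultimately have "M\<^sup>2 * c ^ 4 \<le> real (card (supp h)) * (M * C * P * Y ^ 4 * c ^ 4)"
    using order_trans[OF L2_norm_power4_le[of h] mult_left_mono] by simp
  hence "M * (M * c ^ 4) \<le> (real (card (supp h)) * P * C * Y ^ 4) * (M * c ^ 4)"
    by (simp add: power2_eq_square mult_ac)
  hence "M \<le> real (card (supp h)) * P * C * Y ^ 4"
    using M c by simp
  thus ?thesis
    using M unfolding M_def[symmetric] P_def[symmetric] Y_def[symmetric] by (simp add: field_simps)
qed

lemma dft_diff: "dft (\<lambda>x. u x - v x) m = dft u m - dft v m"
  by (simp add: dft_def algebra_simps sum_subtractf diff_divide_distrib)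

theorem theorem2p2:
  fixes f g :: "'n::nontriv mod_ring ^ 'd::finite \<Rightarrow> complex"
    and E S :: "('n mod_ring ^ 'd) set"
    and C \<alpha> \<beta> \<delta> :: real
  assumes "\<forall>x. x \<notin> E \<longrightarrow> f x = 0"
    and "C > 0"
    and "2 \<le> \<alpha>" and "\<alpha> \<le> 3"
    and "\<forall>U. U \<subseteq> S \<longrightarrow> real (additive_energy U) \<le> C * real (card U) powr \<alpha>"
    and "\<beta> > \<alpha>"
    and "\<delta> = (real (card E) * real (card S) powr (\<beta> - 2) / real (CARD('n) ^ CARD('d))) powr (1 / 4)"
    and "\<delta> < 1 / (2 * (17 + 1 / (1 - 2 powr (- (\<beta> - \<alpha>)))) * (2 * C) powr (1 / 4))"
    and "is_arg_min L2_norm (\<lambda>u. (\<forall>m. m \<notin> S \<longrightarrow> dft u m = dft f m) \<and> card (supp u) = card E) g"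
  shows "f = g"
proof (rule ccontr)
  assume "f \<noteq> g"
  define h where "h x = f x - g x" for x
  define M where "M = real (CARD('n) ^ CARD('d))"
  define P where "P = real (card S) powr (\<beta> - 2)"
  define X where "X = 1 / (1 - 2 powr (- (\<beta> - \<alpha>)))"
  define D where "D = \<delta> * (2 * C) powr (1/4)"
  have g: "\<And>m. m \<notin> S \<Longrightarrow> dft g m = dft f m" "card (supp g) = card E"
    using assms(9) by (auto simp: is_arg_min_def)
  have X: "X \<ge> 0" using \<open>\<beta> > \<alpha>\<close> by (simp add: X_def powr_le_one_le powr_less_one less_imp_le)
  \<comment> \<open>Both supports have at most |E| points. The resulting factor 2 is the one in
    \<open>(2 * C) powr (1/4)\<close>, since D^4 is \<delta>^4 times 2 C.\<close>
  have "supp h \<subseteq> E \<union> supp g" using assms(1) by (auto simp: h_def supp_def)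
  hence "card (supp h) \<le> card E + card (supp g)"
    using card_mono[of "E \<union> supp g" "supp h"] card_Un_le[of E "supp g"] by simp
  hence card_h: "real (card (supp h)) \<le> 2 * real (card E)" using g(2) by simp
  have D0: "D \<ge> 0" by (simp add: D_def assms(7))
  have "1 \<le> real (card (supp h)) * P / M * C * (1 + 2 / (1 - 2 powr (- (\<beta> - \<alpha>)))) ^ 4"
    unfolding P_def M_def
  proof (rule energy_uncertainty_principle)
    show "dft h m = 0" if "m \<notin> S" for m using g(1)[OF that] unfolding h_def dft_diff by simp
    show "h \<noteq> (\<lambda>x. 0)" using \<open>f \<noteq> g\<close> by (auto simp: h_def fun_eq_iff)
  qed (use assms in auto)
  also have "\<dots> = real (card (supp h)) * (P / M * C * (1 + 2 * X) ^ 4)"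
    by (simp add: X_def)
  also have "\<dots> \<le> 2 * real (card E) * (P / M * C * (1 + 2 * X) ^ 4)"
    using \<open>C > 0\<close> X by (intro mult_right_mono card_h) (auto simp: P_def M_def)
  also have "\<dots> = (D * (1 + 2 * X)) ^ 4"
  proof -
    have "\<delta> ^ 4 = real (card E) * P / M"
      unfolding assms(7) P_def M_def by (rule powr_quarter_power4) simp
    thus ?thesis using \<open>C > 0\<close> by (simp add: D_def power_mult_distrib powr_quarter_power4)
  qed
  finally have "1 ^ 4 \<le> (D * (1 + 2 * X)) ^ 4" by simp
  hence "1 \<le> D * (1 + 2 * X)"
    by (rule power_mono_iff[THEN iffD1, rotated 3]) (use D0 X in simp_all)
  \<comment> \<open>The argument yields the constant 1 + 2 X, which is below 2 (17 + X) = 34 + 2 X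
    from the assumed bound on \<delta>.\<close>
  also have "\<dots> \<le> D * (2 * (17 + X))"
    by (intro mult_left_mono) (auto simp: D_def assms(7))
  also have "\<dots> < 1"
  proof -
    have "0 < 2 * (17 + X) * (2 * C) powr (1/4)" using X \<open>C > 0\<close> by (intro mult_pos_pos) auto
    thus ?thesis using assms(8) unfolding D_def X_def[symmetric] by (simp only: pos_less_divide_eq mult_ac)
  qed
  finally show False by simp
qed

end
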